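(* Let $P$ and $Q$ be equivalence relations on a set $U$. Then $\mathit{IRS}(P+Q)$, ordered componentwise by inclusion, is the smallest completion of $\mathit{RS}(P+Q)$ (via the inclusion map $\mathit{RS}(P+Q) \to \mathit{IRS}(P+Q)$).
   Context: For an equivalence relation $E$ on $U$ and $x\in U$, $E(x)=\{y\in U\mid (x,y)\in E\}$. For $X\subseteq U$, the optimistic lower and upper approximations are $X_{P+Q}=\{x\in U\mid P(x)\subseteq X \text{ or } Q(x)\subseteq X\}$ and $X^{P+Q}=\{x\in U\mid P(x)\cap X\neq\emptyset \text{ and } Q(x)\cap X\neq\emptyset\}$. Let $\wp(U)_{P+Q}=\{X_{P+Q}\mid X\subseteq U\}$, $\wp(U)^{P+Q}=\{X^{P+Q}\mid X\subseteq U\}$ and $\mathit{RS}(P+Q)=\{(X_{P+Q},X^{P+Q})\mid X\subseteq U\}$. Let $\Sigma_P=\{x\in U\mid P(x)=\{x\}\}$, $\Sigma_Q=\{x\in U\mid Q(x)=\{x\}\}$, and $\mathit{IRS}(P+Q)=\{(A,B)\in\wp(U)_{P+Q}\times\wp(U)^{P+Q}\mid A\subseteq B \text{ and } (B\setminus A)\cap(\Sigma_P\cup\Sigma_Q)=\emptyset\}$. Both $\mathit{RS}(P+Q)$ and $\mathit{IRS}(P+Q)$ are ordered by $(A,B)\leq(C,D)$ iff $A\subseteq C$ and $B\subseteq D$; one has $\mathit{RS}(P+Q)\subseteq\mathit{IRS}(P+Q)$. A complete lattice $L$ is a completion of an ordered set $S$ via $\varphi$ if $\varphi\colon S\to L$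 is an order-embedding. For $A\subseteq S$ let $A^u$ and $A^l$ be the sets of upper and lower bounds of $A$ in $S$, and let $\mathrm{DM}(S)=\{A\subseteq S\mid A^{ul}=A\}$, ordered by inclusion (the Dedekind--MacNeille completion of $S$), with the order-embedding $\Phi\colon S\to\mathrm{DM}(S)$, $\Phi(x)=\{y\in S\mid y\leq x\}$. The Dedekind--MacNeille completion is the smallest completion in the sense that for each completion $L$ of $S$ via $\varphi$ there is an order-embedding $\Psi\colon\mathrm{DM}(S)\to L$ with $\varphi=\Psi\circ\Phi$. That a completion $L$ of $S$ via $\varphi$ is "the smallest completion" means that it is the Dedekind--MacNeille completion of $S$, i.e. there is an order-isomorphism $\Theta\colon\mathrm{DM}(S)\to L$ with $\Theta\circ\Phi=\varphi$. *)

theory Defs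
  imports "HOL-Algebra.Complete_Lattice"
begin

section \<open>Completions of ordered sets\<close>

definition order_embedding ::
  "'a gorder \<Rightarrow> 'b gorder \<Rightarrow> ('a \<Rightarrow> 'b) \<Rightarrow> bool" where
  "order_embedding S L \<phi> \<longleftrightarrow>
     \<phi> \<in> carrier S \<rightarrow> carrier L \<and>
     (\<forall>x\<in>carrier S. \<forall>y\<in>carrier S. x \<sqsubseteq>\<^bsub>S\<^esub> y \<longleftrightarrow> \<phi> x \<sqsubseteq>\<^bsub>L\<^esub> \<phi> y)"

definition order_isomorphism ::
  "'a gorder \<Rightarrow> 'b gorder \<Rightarrow> ('a \<Rightarrow> 'b) \<Rightarrow> bool" where
  "order_isomorphism S L \<Theta> \<longleftrightarrow>
     order_embedding S L \<Theta> \<and> \<Theta> ` carrier S = carrier L"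

definition is_completion ::
  "'a gorder \<Rightarrow> 'b gorder \<Rightarrow> ('a \<Rightarrow> 'b) \<Rightarrow> bool" where
  "is_completion S L \<phi> \<longleftrightarrow>
     partial_order S \<and> complete_lattice L \<and> order_embedding S L \<phi>"

definition DM :: "'a gorder \<Rightarrow> 'a set gorder" where
  "DM S = \<lparr> carrier = {A. A \<subseteq> carrier S \<and> Lower S (Upper S A) = A},
            eq = (=), le = (\<subseteq>) \<rparr>"

definition DM_embed :: "'a gorder \<Rightarrow> 'a \<Rightarrow> 'a set" where
  "DM_embed S x = {y \<in> carrier S. y \<sqsubseteq>\<^bsub>S\<^esub> x}"

text \<open>A completion is called the smallest one if it is the Dedekind--MacNeille
  completion up to an order-isomorphism that commutes with the two embeddings.\<close>

definition is_smallest_completion ::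
  "'a gorder \<Rightarrow> 'b gorder \<Rightarrow> ('a \<Rightarrow> 'b) \<Rightarrow> bool" where
  "is_smallest_completion S L \<phi> \<longleftrightarrow>
     is_completion S L \<phi> \<and>
     (\<exists>\<Theta>. order_isomorphism (DM S) L \<Theta> \<and>
          (\<forall>x\<in>carrier S. \<Theta> (DM_embed S x) = \<phi> x))"

section \<open>Optimistic approximations\<close>

definition opt_lower ::
  "'a set \<Rightarrow> ('a \<times> 'a) set \<Rightarrow> ('a \<times> 'a) set \<Rightarrow> 'a set \<Rightarrow> 'a set" where
  "opt_lower U P Q X = {x \<in> U. P `` {x} \<subseteq> X \<or> Q `` {x} \<subseteq> X}"

definition opt_upper ::
  "'a set \<Rightarrow> ('a \<times> 'a) set \<Rightarrow> ('a \<times> 'a) set \<Rightarrow> 'a set \<Rightarrow> 'a set" where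
  "opt_upper U P Q X = {x \<in> U. P `` {x} \<inter> X \<noteq> {} \<and> Q `` {x} \<inter> X \<noteq> {}}"

definition singletons :: "'a set \<Rightarrow> ('a \<times> 'a) set \<Rightarrow> 'a set" where
  "singletons U E = {x \<in> U. E `` {x} = {x}}"

definition RS_set ::
  "'a set \<Rightarrow> ('a \<times> 'a) set \<Rightarrow> ('a \<times> 'a) set \<Rightarrow> ('a set \<times> 'a set) set" where
  "RS_set U P Q = {(opt_lower U P Q X, opt_upper U P Q X) | X. X \<subseteq> U}"

definition IRS_set ::
  "'a set \<Rightarrow> ('a \<times> 'a) set \<Rightarrow> ('a \<times> 'a) set \<Rightarrow> ('a set \<times> 'a set) set" where
  "IRS_set U P Q =
     {(A, B) \<in> (opt_lower U P Q ` Pow U) \<times> (opt_upper U P Q ` Pow U).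
        A \<subseteq> B \<and> (B - A) \<inter> (singletons U P \<union> singletons U Q) = {}}"

definition componentwise :: "('a set \<times> 'a set) set \<Rightarrow> ('a set \<times> 'a set) gorder" where
  "componentwise C = \<lparr> carrier = C, eq = (=),
     le = (\<lambda>p q. fst p \<subseteq> fst q \<and> snd p \<subseteq> snd q) \<rparr>"

abbreviation RS ::
  "'a set \<Rightarrow> ('a \<times> 'a) set \<Rightarrow> ('a \<times> 'a) set \<Rightarrow> ('a set \<times> 'a set) gorder" where
  "RS U P Q \<equiv> componentwise (RS_set U P Q)"

abbreviation IRS ::
  "'a set \<Rightarrow> ('a \<times> 'a) set \<Rightarrow> ('a \<times> 'a) set \<Rightarrow> ('a set \<times> 'a set) gorder" where
  "IRS U P Q \<equiv> componentwise (IRS_set U P Q)"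

end

theory Submission
  imports Defs
begin

text \<open>A completion of \<open>S\<close> in which \<open>S\<close> is both join-dense and meet-dense is the
  Dedekind--MacNeille completion; the isomorphism sends a cut to its supremum. The set \<open>RS(P+Q)\<close>
  is dense in \<open>IRS(P+Q)\<close> for the following reason. If \<open>(A,B)\<close> is in \<open>IRS(P+Q)\<close>, then the
  approximations of \<open>A\<close> lie below \<open>(A,B)\<close> and have first component \<open>A\<close>, and every
  \<open>x \<in> B - A\<close> lies outside \<open>\<Sigma>\<^sub>P \<union> \<Sigma>\<^sub>Q\<close>, so that \<open>{x}\<close> has empty lower approximation while its
  upper approximation contains \<open>x\<close> and is contained in \<open>B\<close>. Dually, one uses the approximations
  of \<open>B\<close> and of \<open>U - {x}\<close>.\<close>

text \<open>The two hypotheses express density without \<open>\<Squnion>\<close> and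
  \<open>\<Sqinter>\<close>: the first makes each \<open>p\<close> the least upper bound of the
  \<open>\<phi> s\<close> below it, the second makes each \<open>q\<close> the greatest lower bound
  of the \<open>\<phi> s\<close> above it.\<close>

lemma is_smallest_completionI:
  assumes compl: "is_completion S L \<phi>"
    and join_dense: "\<And>p q. \<lbrakk>p \<in> carrier L; q \<in> carrier L;
      \<And>s. \<lbrakk>s \<in> carrier S; \<phi> s \<sqsubseteq>\<^bsub>L\<^esub> p\<rbrakk> \<Longrightarrow> \<phi> s \<sqsubseteq>\<^bsub>L\<^esub> q\<rbrakk> \<Longrightarrow> p \<sqsubseteq>\<^bsub>L\<^esub> q"
    and meet_dense: "\<And>p q. \<lbrakk>p \<in> carrier L; q \<in> carrier L;
      \<And>s. \<lbrakk>s \<in> carrier S; q \<sqsubseteq>\<^bsub>L\<^esub> \<phi> s\<rbrakk> \<Longrightarrow> p \<sqsubseteq>\<^bsub>L\<^esub> \<phi> s\<rbrakk> \<Longrightarrow> p \<sqsubseteq>\<^bsub>L\<^esub> q"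
  shows "is_smallest_completion S L \<phi>"
proof -
  interpret S: partial_order S using compl by (simp add: is_completion_def)
  interpret L: complete_lattice L using compl by (simp add: is_completion_def)
  have \<phi>_closed: "\<phi> s \<in> carrier L" if "s \<in> carrier S" for s
    using compl that by (auto simp: is_completion_def order_embedding_def)
  have \<phi>_le: "\<phi> s \<sqsubseteq>\<^bsub>L\<^esub> \<phi> t \<longleftrightarrow> s \<sqsubseteq>\<^bsub>S\<^esub> t" if "s \<in> carrier S" "t \<in> carrier S" for s t
    using compl that by (auto simp: is_completion_def order_embedding_def)
  define \<Theta> where "\<Theta> D = \<Squnion>\<^bsub>L\<^esub> (\<phi> ` D)" for D
  have \<Theta>_closed: "\<Theta> D \<in> carrier L" if "D \<subseteq> carrier S" for D
    unfolding \<Theta>_def using that \<phi>_closed by (intro L.sup_closed) auto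
  have \<Theta>_upper: "\<phi> s \<sqsubseteq>\<^bsub>L\<^esub> \<Theta> D" if "D \<subseteq> carrier S" "s \<in> D" for D s
    unfolding \<Theta>_def using that \<phi>_closed by (intro L.sup_upper) auto
  have \<Theta>_least: "\<Theta> D \<sqsubseteq>\<^bsub>L\<^esub> p"
    if "D \<subseteq> carrier S" "p \<in> carrier L" "\<And>s. s \<in> D \<Longrightarrow> \<phi> s \<sqsubseteq>\<^bsub>L\<^esub> p" for D p
    unfolding \<Theta>_def using that \<phi>_closed by (intro L.sup_least) (auto simp: Upper_def)
  \<comment> \<open>A cut can be recovered from its supremum: an element below
    \<open>\<Theta> D\<close> is below \<open>\<phi> u\<close> for every upper bound
    \<open>u\<close> of \<open>D\<close>, hence lies in \<open>Lower S (Upper S D) = D\<close>. This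
    is what makes \<open>\<Theta>\<close> reflect the order.\<close>
  have mem_cut: "s \<in> D \<longleftrightarrow> \<phi> s \<sqsubseteq>\<^bsub>L\<^esub> \<Theta> D" if D: "D \<in> carrier (DM S)" and s: "s \<in> carrier S" for D s
  proof
    have sub: "D \<subseteq> carrier S" and cut: "Lower S (Upper S D) = D"
      using D by (auto simp: DM_def)
    show "\<phi> s \<sqsubseteq>\<^bsub>L\<^esub> \<Theta> D" if "s \<in> D" using \<Theta>_upper sub that by blast
    assume le: "\<phi> s \<sqsubseteq>\<^bsub>L\<^esub> \<Theta> D"
    have "s \<sqsubseteq>\<^bsub>S\<^esub> u" if u: "u \<in> Upper S D" for u
    proof -
      have uS: "u \<in> carrier S" using u by (auto simp: Upper_def)
      have "\<Theta> D \<sqsubseteq>\<^bsub>L\<^esub> \<phi> u"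
        using u sub uS by (intro \<Theta>_least) (auto simp: \<phi>_closed \<phi>_le Upper_def)
      with le have "\<phi> s \<sqsubseteq>\<^bsub>L\<^esub> \<phi> u"
        by (rule L.le_trans) (use sub s uS in \<open>auto intro: \<phi>_closed \<Theta>_closed\<close>)
      then show ?thesis using \<phi>_le[OF s uS] by simp
    qed
    then have "s \<in> Lower S (Upper S D)" using s by (auto simp: Lower_def)
    then show "s \<in> D" using cut by simp
  qed
  have surj: "\<exists>D \<in> carrier (DM S). \<Theta> D = p" if p: "p \<in> carrier L" for p
  proof -
    \<comment> \<open>By \<open>mem_cut\<close>, no other cut can have supremum \<open>p\<close>.
      Meet-density shows that \<open>D\<close> is a cut, since every \<open>s\<close> with
      \<open>\<phi> s\<close> above \<open>p\<close> is an upper bound of \<open>D\<close>;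
      join-density then shows that its supremum reaches \<open>p\<close>.\<close>
    define D where "D = {s \<in> carrier S. \<phi> s \<sqsubseteq>\<^bsub>L\<^esub> p}"
    have sub: "D \<subseteq> carrier S" by (auto simp: D_def)
    have "r \<in> D" if r: "r \<in> Lower S (Upper S D)" for r
    proof -
      have rS: "r \<in> carrier S" using r by (auto simp: Lower_def)
      have "\<phi> r \<sqsubseteq>\<^bsub>L\<^esub> \<phi> s" if s: "s \<in> carrier S" "p \<sqsubseteq>\<^bsub>L\<^esub> \<phi> s" for s
      proof -
        have "t \<sqsubseteq>\<^bsub>S\<^esub> s" if "t \<in> D" for t
          using that s p L.le_trans[of "\<phi> t" p "\<phi> s"] \<phi>_le[of t s] \<phi>_closed[of t] \<phi>_closed[of s]
          by (simp add: D_def)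
        then have "s \<in> Upper S D" using s by (auto simp: Upper_def)
        then have "r \<sqsubseteq>\<^bsub>S\<^esub> s" using r s by (auto simp: Lower_def)
        then show ?thesis using \<phi>_le[OF rS s(1)] by simp
      qed
      then have "\<phi> r \<sqsubseteq>\<^bsub>L\<^esub> p" by (rule meet_dense[OF \<phi>_closed[OF rS] p])
      then show ?thesis using rS by (simp add: D_def)
    qed
    moreover have "D \<subseteq> Lower S (Upper S D)"
      using sub by (auto simp: Lower_def Upper_def)
    ultimately have "D \<in> carrier (DM S)" using sub by (auto simp: DM_def)
    moreover have "\<Theta> D \<sqsubseteq>\<^bsub>L\<^esub> p" using sub p by (intro \<Theta>_least) (auto simp: D_def)
    moreover have "p \<sqsubseteq>\<^bsub>L\<^esub> \<Theta> D"
      using \<Theta>_upper[OF sub] by (intro join_dense[OF p \<Theta>_closed[OF sub]]) (simp add: D_def)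
    ultimately show ?thesis using L.le_antisym[OF _ _ \<Theta>_closed[OF sub] p] by blast
  qed
  have DM_sub: "D \<subseteq> carrier S" if "D \<in> carrier (DM S)" for D
    using that by (simp add: DM_def)
  have \<Theta>_le: "\<Theta> D \<sqsubseteq>\<^bsub>L\<^esub> \<Theta> E \<longleftrightarrow> D \<subseteq> E"
    if DE: "D \<in> carrier (DM S)" "E \<in> carrier (DM S)" for D E
  proof
    show "\<Theta> D \<sqsubseteq>\<^bsub>L\<^esub> \<Theta> E" if "D \<subseteq> E"
      using \<Theta>_upper[OF DM_sub[OF DE(2)]] that
      by (intro \<Theta>_least DM_sub[OF DE(1)] \<Theta>_closed DM_sub[OF DE(2)]) blast
    assume le: "\<Theta> D \<sqsubseteq>\<^bsub>L\<^esub> \<Theta> E"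
    show "D \<subseteq> E"
    proof
      fix s assume "s \<in> D"
      then have s: "s \<in> carrier S" using DM_sub[OF DE(1)] by blast
      then have "\<phi> s \<sqsubseteq>\<^bsub>L\<^esub> \<Theta> D" using mem_cut[OF DE(1)] \<open>s \<in> D\<close> by blast
      then have "\<phi> s \<sqsubseteq>\<^bsub>L\<^esub> \<Theta> E"
        using le by (rule L.le_trans) (use s DE DM_sub \<phi>_closed \<Theta>_closed in simp_all)
      then show "s \<in> E" using mem_cut[OF DE(2) s] by simp
    qed
  qed
  have iso: "order_isomorphism (DM S) L \<Theta>"
    unfolding order_isomorphism_def order_embedding_def
  proof (intro conjI ballI)
    show "\<Theta> \<in> carrier (DM S) \<rightarrow> carrier L" using \<Theta>_closed DM_sub by auto
    show "\<Theta> ` carrier (DM S) = carrier L" using \<Theta>_closed DM_sub surj by (force simp: image_iff)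
    show "D \<sqsubseteq>\<^bsub>DM S\<^esub> E \<longleftrightarrow> \<Theta> D \<sqsubseteq>\<^bsub>L\<^esub> \<Theta> E"
      if "D \<in> carrier (DM S)" "E \<in> carrier (DM S)" for D E
      using \<Theta>_le[OF that] by (simp add: DM_def)
  qed
  have "\<Theta> (DM_embed S x) = \<phi> x" if x: "x \<in> carrier S" for x
  proof (rule L.le_antisym)
    have sub: "DM_embed S x \<subseteq> carrier S" by (auto simp: DM_embed_def)
    show "\<Theta> (DM_embed S x) \<sqsubseteq>\<^bsub>L\<^esub> \<phi> x"
      using sub x \<phi>_closed \<phi>_le by (intro \<Theta>_least) (auto simp: DM_embed_def)
    show "\<phi> x \<sqsubseteq>\<^bsub>L\<^esub> \<Theta> (DM_embed S x)"
      using sub x by (intro \<Theta>_upper) (auto simp: DM_embed_def)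
    show "\<Theta> (DM_embed S x) \<in> carrier L" "\<phi> x \<in> carrier L"
      using sub x \<phi>_closed \<Theta>_closed by auto
  qed
  then show ?thesis using compl iso by (auto simp: is_smallest_completion_def)
qed

section \<open>Sets of pairs ordered by componentwise inclusion\<close>

lemma componentwise_simps [simp]:
  "carrier (componentwise C) = C"
  "p \<sqsubseteq>\<^bsub>componentwise C\<^esub> q \<longleftrightarrow> fst p \<subseteq> fst q \<and> snd p \<subseteq> snd q"
  "p .=\<^bsub>componentwise C\<^esub> q \<longleftrightarrow> p = q"
  by (simp_all add: componentwise_def)

lemma partial_order_componentwise: "partial_order (componentwise C)"
  by unfold_locales (auto simp: prod_eq_iff fun_eq_iff)

text \<open>Reduces completeness to plain inclusions between components, so that explicit bounds can
  be exhibited. The family \<open>F\<close> may be empty, which yields bottom and top.\<close>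

lemma complete_lattice_componentwiseI:
  assumes sup: "\<And>F. F \<subseteq> C \<Longrightarrow> \<exists>s\<in>C. (\<forall>p\<in>F. fst p \<subseteq> fst s \<and> snd p \<subseteq> snd s) \<and>
      (\<forall>q\<in>C. (\<forall>p\<in>F. fst p \<subseteq> fst q \<and> snd p \<subseteq> snd q) \<longrightarrow> fst s \<subseteq> fst q \<and> snd s \<subseteq> snd q)"
    and inf: "\<And>F. F \<subseteq> C \<Longrightarrow> \<exists>i\<in>C. (\<forall>p\<in>F. fst i \<subseteq> fst p \<and> snd i \<subseteq> snd p) \<and>
      (\<forall>q\<in>C. (\<forall>p\<in>F. fst q \<subseteq> fst p \<and> snd q \<subseteq> snd p) \<longrightarrow> fst q \<subseteq> fst i \<and> snd q \<subseteq> snd i)"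
  shows "complete_lattice (componentwise C)"
proof -
  interpret partial_order "componentwise C" by (rule partial_order_componentwise)
  show ?thesis
  proof
    fix F assume "F \<subseteq> carrier (componentwise C)"
    then have F: "F \<subseteq> C" by simp
    have Upper_F: "y \<in> C \<and> (\<forall>p\<in>F. fst p \<subseteq> fst y \<and> snd p \<subseteq> snd y)"
      if "y \<in> Upper (componentwise C) F" for y
      using Upper_memD[OF that] Upper_closed[of "componentwise C" F] F that by auto
    have Lower_F: "y \<in> C \<and> (\<forall>p\<in>F. fst y \<subseteq> fst p \<and> snd y \<subseteq> snd p)"
      if "y \<in> Lower (componentwise C) F" for y
      using Lower_memD[OF that] Lower_closed[of "componentwise C" F] F that by auto
    obtain s where s: "s \<in> C" "\<forall>p\<in>F. fst p \<subseteq> fst s \<and> snd p \<subseteq> snd s"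
      "\<forall>q\<in>C. (\<forall>p\<in>F. fst p \<subseteq> fst q \<and> snd p \<subseteq> snd q) \<longrightarrow> fst s \<subseteq> fst q \<and> snd s \<subseteq> snd q"
      using sup[OF F] by metis
    have "least (componentwise C) s (Upper (componentwise C) F)"
      using s F Upper_F by (intro least_UpperI) simp_all
    then show "\<exists>s. least (componentwise C) s (Upper (componentwise C) F)" ..
    obtain i where i: "i \<in> C" "\<forall>p\<in>F. fst i \<subseteq> fst p \<and> snd i \<subseteq> snd p"
      "\<forall>q\<in>C. (\<forall>p\<in>F. fst q \<subseteq> fst p \<and> snd q \<subseteq> snd p) \<longrightarrow> fst q \<subseteq> fst i \<and> snd q \<subseteq> snd i"
      using inf[OF F] by metis
    have "greatest (componentwise C) i (Lower (componentwise C) F)"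
      using i F Lower_F by (intro greatest_LowerI) simp_all
    then show "\<exists>i. greatest (componentwise C) i (Lower (componentwise C) F)" ..
  qed
qed

section \<open>Optimistic approximations as dual interior and closure operators\<close>

locale two_equivs =
  fixes U :: "'a set" and P Q :: "('a \<times> 'a) set"
  assumes equiv_P: "equiv U P" and equiv_Q: "equiv U Q"
begin

abbreviation "lo \<equiv> opt_lower U P Q"
abbreviation "up \<equiv> opt_upper U P Q"
abbreviation "\<Sigma> \<equiv> singletons U P \<union> singletons U Q"

lemma class_refl: "x \<in> U \<Longrightarrow> x \<in> P `` {x}" "x \<in> U \<Longrightarrow> x \<in> Q `` {x}"
  using equiv_class_self[OF equiv_P] equiv_class_self[OF equiv_Q] by auto

lemma class_sub: "P `` {x} \<subseteq> U" "Q `` {x} \<subseteq> U"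
  using equiv_P equiv_Q by (auto simp: equiv_def refl_on_def)

lemma class_eq: "y \<in> P `` {x} \<Longrightarrow> P `` {y} = P `` {x}" "y \<in> Q `` {x} \<Longrightarrow> Q `` {y} = Q `` {x}"
  using equiv_class_eq[OF equiv_P] equiv_class_eq[OF equiv_Q] by blast+

lemma lo_sub: "lo X \<subseteq> X"
  unfolding opt_lower_def using class_refl by blast

lemma lo_carrier: "lo X \<subseteq> U"
  by (auto simp: opt_lower_def)

lemma lo_mono: "X \<subseteq> Y \<Longrightarrow> lo X \<subseteq> lo Y"
  unfolding opt_lower_def by blast

text \<open>All points of a class have that same class. So if the class of \<open>x\<close> lies in
  \<open>X\<close>, it witnesses membership in \<open>lo X\<close> for each of its points and is
  therefore contained in \<open>lo X\<close>.\<close>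

lemma lo_idem: "lo (lo X) = lo X"
proof
  show "lo X \<subseteq> lo (lo X)"
  proof
    fix x assume x: "x \<in> lo X"
    then consider "P `` {x} \<subseteq> X" | "Q `` {x} \<subseteq> X" by (auto simp: opt_lower_def)
    then have "P `` {x} \<subseteq> lo X \<or> Q `` {x} \<subseteq> lo X"
    proof cases
      case 1
      then have "y \<in> lo X" if "y \<in> P `` {x}" for y
        using class_eq(1)[OF that] class_sub that unfolding opt_lower_def by blast
      then show ?thesis by blast
    next
      case 2
      then have "y \<in> lo X" if "y \<in> Q `` {x}" for y
        using class_eq(2)[OF that] class_sub that unfolding opt_lower_def by blast
      then show ?thesis by blast
    qed
    then show "x \<in> lo (lo X)" using x lo_carrier by (subst opt_lower_def) blast
  qed
qed (rule lo_sub)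

text \<open>Classes stay inside \<open>U\<close>, so a class misses \<open>X\<close> exactly if it
  is contained in \<open>U - X\<close>. This duality transfers idempotence from \<open>lo\<close> to
  \<open>up\<close>.\<close>

lemma up_eq_lo: "up X = U - lo (U - X)"
  unfolding opt_lower_def opt_upper_def using class_sub by blast

lemma up_carrier: "up X \<subseteq> U"
  by (auto simp: opt_upper_def)

lemma up_sup: "X \<subseteq> U \<Longrightarrow> X \<subseteq> up X"
  unfolding opt_upper_def using class_refl by blast

lemma up_mono: "X \<subseteq> Y \<Longrightarrow> up X \<subseteq> up Y"
  unfolding opt_upper_def by blast

lemma up_idem: "up (up X) = up X"
proof -
  have "U - (U - lo (U - X)) = lo (U - X)" using lo_carrier by blast
  then show ?thesis by (simp add: up_eq_lo lo_idem)
qed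

text \<open>A singleton class decides membership exactly. Together with \<open>singleton_up\<close>
  this means that no approximation changes a set at the points of \<open>\<Sigma>\<close>, which
  explains the boundary condition in \<open>IRS_set\<close>.\<close>

lemma singleton_lo: "x \<in> \<Sigma> \<Longrightarrow> x \<in> X \<Longrightarrow> x \<in> lo X"
  by (auto simp: singletons_def opt_lower_def)

lemma singleton_up: "x \<in> \<Sigma> \<Longrightarrow> x \<in> up X \<Longrightarrow> x \<in> X"
  by (auto simp: singletons_def opt_upper_def)

text \<open>Idempotence turns the ranges of \<open>lo\<close> and \<open>up\<close> into their sets
  of fixed points; all later arguments use this form.\<close>

lemma mem_IRS_iff:
  "p \<in> IRS_set U P Q \<longleftrightarrow>
     snd p \<subseteq> U \<and> lo (fst p) = fst p \<and> up (snd p) = snd p \<and> fst p \<subseteq> snd p \<and>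
     (\<forall>x \<in> \<Sigma>. x \<in> snd p \<longrightarrow> x \<in> fst p)"
proof -
  have "A \<in> lo ` Pow U \<longleftrightarrow> lo A = A" for A
    using lo_idem lo_carrier by (metis Pow_iff imageE imageI)
  moreover have "B \<in> up ` Pow U \<longleftrightarrow> up B = B" for B
    using up_idem up_carrier by (metis Pow_iff imageE imageI)
  moreover have "snd p \<subseteq> U" if "up (snd p) = snd p" using up_carrier that by metis
  ultimately show ?thesis
    unfolding IRS_set_def by (cases p) auto
qed

section \<open>Rough sets and completeness of the enlarged order\<close>

lemma approx_RS: "X \<subseteq> U \<Longrightarrow> (lo X, up X) \<in> RS_set U P Q"
  by (auto simp: RS_set_def)

lemma RS_sub_IRS: "RS_set U P Q \<subseteq> IRS_set U P Q"
proof
  fix p assume "p \<in> RS_set U P Q"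
  then obtain X where X: "X \<subseteq> U" "p = (lo X, up X)" by (auto simp: RS_set_def)
  moreover have "lo X \<subseteq> up X" using lo_sub up_sup X by blast
  moreover have "x \<in> lo X" if "x \<in> \<Sigma>" "x \<in> up X" for x
    using singleton_lo singleton_up that by blast
  ultimately show "p \<in> IRS_set U P Q"
    using up_carrier by (auto simp: mem_IRS_iff lo_idem up_idem)
qed

text \<open>Fixed points of \<open>lo\<close> are closed under unions and those of \<open>up\<close>
  under intersections. Hence a supremum is a union with only its second component closed by
  \<open>up\<close>, and an infimum is an intersection with only its first component shrunk by
  \<open>lo\<close>. Neither correction affects points of \<open>\<Sigma>\<close>, so the boundary
  condition survives.\<close>

lemma complete_lattice_IRS: "complete_lattice (IRS U P Q)"
proof (rule complete_lattice_componentwiseI)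
  fix F assume F: "F \<subseteq> IRS_set U P Q"
  then have mem: "snd p \<subseteq> U" "lo (fst p) = fst p" "up (snd p) = snd p" "fst p \<subseteq> snd p"
      "x \<in> \<Sigma> \<Longrightarrow> x \<in> snd p \<Longrightarrow> x \<in> fst p" if "p \<in> F" for p x
    using that mem_IRS_iff by blast+
  show "\<exists>s\<in>IRS_set U P Q. (\<forall>p\<in>F. fst p \<subseteq> fst s \<and> snd p \<subseteq> snd s) \<and>
      (\<forall>q\<in>IRS_set U P Q. (\<forall>p\<in>F. fst p \<subseteq> fst q \<and> snd p \<subseteq> snd q) \<longrightarrow>
        fst s \<subseteq> fst q \<and> snd s \<subseteq> snd q)"
  proof (intro bexI conjI ballI impI)
    let ?A = "\<Union>p\<in>F. fst p" and ?B = "\<Union>p\<in>F. snd p"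
    have BU: "?B \<subseteq> U" using mem by blast
    have "fst p \<subseteq> lo ?A" if "p \<in> F" for p
      using lo_mono[of "fst p" ?A] mem(2)[OF that] that by auto
    then have "lo ?A = ?A" using lo_sub[of ?A] by blast
    moreover have "?A \<subseteq> up ?B" using mem(4) up_sup[OF BU] by blast
    moreover have "x \<in> ?A" if "x \<in> \<Sigma>" "x \<in> up ?B" for x
      using singleton_up[OF that] mem(5) that(1) by blast
    ultimately show "(?A, up ?B) \<in> IRS_set U P Q"
      using up_carrier by (auto simp: mem_IRS_iff up_idem)
    show "fst p \<subseteq> fst (?A, up ?B)" "snd p \<subseteq> snd (?A, up ?B)" if "p \<in> F" for p
      using that up_sup[OF BU] by auto
    fix q assume q: "q \<in> IRS_set U P Q" and ub: "\<forall>p\<in>F. fst p \<subseteq> fst q \<and> snd p \<subseteq> snd q"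
    then show "fst (?A, up ?B) \<subseteq> fst q" by auto
    have "up ?B \<subseteq> up (snd q)" using ub by (intro up_mono) auto
    then show "snd (?A, up ?B) \<subseteq> snd q" using q by (simp add: mem_IRS_iff)
  qed
  show "\<exists>i\<in>IRS_set U P Q. (\<forall>p\<in>F. fst i \<subseteq> fst p \<and> snd i \<subseteq> snd p) \<and>
      (\<forall>q\<in>IRS_set U P Q. (\<forall>p\<in>F. fst q \<subseteq> fst p \<and> snd q \<subseteq> snd p) \<longrightarrow>
        fst q \<subseteq> fst i \<and> snd q \<subseteq> snd i)"
  proof (intro bexI conjI ballI impI)
    \<comment> \<open>Intersecting with \<open>U\<close> matters only for \<open>F = {}\<close>.\<close>
    let ?A = "U \<inter> (\<Inter>p\<in>F. fst p)" and ?B = "U \<inter> (\<Inter>p\<in>F. snd p)"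
    have "up ?B \<subseteq> snd p" if "p \<in> F" for p
      using up_mono[of ?B "snd p"] mem(3)[OF that] that by auto
    then have "up ?B = ?B" using up_sup[of ?B] up_carrier[of ?B] by blast
    moreover have "lo ?A \<subseteq> ?B" using mem(4) lo_sub[of ?A] by blast
    moreover have "x \<in> lo ?A" if "x \<in> \<Sigma>" "x \<in> ?B" for x
      using singleton_lo[OF that(1), of ?A] mem(5) that by blast
    ultimately show "(lo ?A, ?B) \<in> IRS_set U P Q"
      by (auto simp: mem_IRS_iff lo_idem)
    show "fst (lo ?A, ?B) \<subseteq> fst p" "snd (lo ?A, ?B) \<subseteq> snd p" if "p \<in> F" for p
      using that lo_sub[of ?A] by auto
    fix q assume q: "q \<in> IRS_set U P Q" and lb: "\<forall>p\<in>F. fst q \<subseteq> fst p \<and> snd q \<subseteq> snd p"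
    then show "snd q \<subseteq> snd (lo ?A, ?B)" by (auto simp: mem_IRS_iff)
    have "fst q \<subseteq> U" using q by (auto simp: mem_IRS_iff)
    then have "lo (fst q) \<subseteq> lo ?A" using lb by (intro lo_mono) auto
    then show "fst q \<subseteq> fst (lo ?A, ?B)" using q by (simp add: mem_IRS_iff)
  qed
qed

section \<open>Join-density and meet-density of the rough sets\<close>

lemma RS_join_dense:
  assumes p: "p \<in> IRS_set U P Q"
    and below: "\<And>s. \<lbrakk>s \<in> RS_set U P Q; fst s \<subseteq> fst p; snd s \<subseteq> snd p\<rbrakk>
      \<Longrightarrow> fst s \<subseteq> A \<and> snd s \<subseteq> B"
  shows "fst p \<subseteq> A \<and> snd p \<subseteq> B"
proof -
  have BU: "snd p \<subseteq> U" and A: "lo (fst p) = fst p" and B: "up (snd p) = snd p"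
    and AB: "fst p \<subseteq> snd p" and \<Sigma>: "\<And>x. x \<in> \<Sigma> \<Longrightarrow> x \<in> snd p \<Longrightarrow> x \<in> fst p"
    using p mem_IRS_iff by blast+
  have AU: "fst p \<subseteq> U" using AB BU by blast
  \<comment> \<open>The approximations of \<open>fst p\<close> settle the first component
    completely; only points of \<open>snd p\<close> outside \<open>fst p\<close> remain.\<close>
  have *: "fst p \<subseteq> A \<and> up (fst p) \<subseteq> B"
    using below[OF approx_RS[OF AU]] up_mono[OF AB] by (simp add: A B)
  have "x \<in> B" if x: "x \<in> snd p" for x
  proof (cases "x \<in> fst p")
    case True
    then show ?thesis using * up_sup[OF AU] by blast
  next
    case False
    have xU: "x \<in> U" using x BU by blast
    have "x \<notin> \<Sigma>" using False \<Sigma> x by blast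
    \<comment> \<open>Outside \<open>\<Sigma>\<close>, both classes of \<open>x\<close> contain a
      second point, so neither fits into \<open>{x}\<close>. Hence the rough set of
      \<open>{x}\<close> puts no demand on the first component.\<close>
    then have "lo {x} = {}"
      using lo_sub[of "{x}"] class_refl[OF xU] xU by (auto simp: opt_lower_def singletons_def)
    moreover have "up {x} \<subseteq> snd p" using up_mono[of "{x}" "snd p"] x B by simp
    ultimately have "up {x} \<subseteq> B" using below[OF approx_RS[of "{x}"]] xU by simp
    then show ?thesis using up_sup[of "{x}"] xU by blast
  qed
  then show ?thesis using * by blast
qed

lemma RS_meet_dense:
  assumes p: "p \<in> IRS_set U P Q"
    and above: "\<And>s. \<lbrakk>s \<in> RS_set U P Q; fst p \<subseteq> fst s; snd p \<subseteq> snd s\<rbrakk>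
      \<Longrightarrow> A \<subseteq> fst s \<and> B \<subseteq> snd s"
  shows "A \<subseteq> fst p \<and> B \<subseteq> snd p"
proof -
  have BU: "snd p \<subseteq> U" and A: "lo (fst p) = fst p" and B: "up (snd p) = snd p"
    and AB: "fst p \<subseteq> snd p" and \<Sigma>: "\<And>x. x \<in> \<Sigma> \<Longrightarrow> x \<in> snd p \<Longrightarrow> x \<in> fst p"
    using p mem_IRS_iff by blast+
  \<comment> \<open>The approximations of \<open>snd p\<close> settle the second component and
    confine \<open>A\<close> to \<open>snd p\<close>, so only boundary points still have to be
    excluded from \<open>A\<close>.\<close>
  have *: "A \<subseteq> lo (snd p) \<and> B \<subseteq> snd p"
    using above[OF approx_RS[OF BU]] lo_mono[OF AB] by (simp add: A B)
  have "x \<notin> A" if x: "x \<notin> fst p" for x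
  proof (cases "x \<in> snd p")
    case False
    then show ?thesis using * lo_sub by blast
  next
    case True
    have xU: "x \<in> U" using True BU by blast
    have "x \<notin> \<Sigma>" using True \<Sigma> x by blast
    then have "lo {x} = {}"
      using lo_sub[of "{x}"] class_refl[OF xU] xU by (auto simp: opt_lower_def singletons_def)
    moreover have "U - (U - {x}) = {x}" using xU by blast
    \<comment> \<open>By duality, emptiness of \<open>lo {x}\<close> makes this upper approximation
      all of \<open>U\<close>. The rough set of \<open>U - {x}\<close> therefore lies above
      \<open>p\<close>, while its first component omits \<open>x\<close>.\<close>
    ultimately have "up (U - {x}) = U" by (simp add: up_eq_lo)
    moreover have "fst p \<subseteq> lo (U - {x})"
      using lo_mono[of "fst p" "U - {x}"] x AB BU A by auto
    ultimately have "A \<subseteq> lo (U - {x})" using above[OF approx_RS[of "U - {x}"]] BU by simp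
    then show ?thesis using lo_sub[of "U - {x}"] by blast
  qed
  then show ?thesis using * by blast
qed

end

theorem theorem4p5:
  fixes U :: "'a set" and P Q :: "('a \<times> 'a) set"
  assumes "equiv U P" and "equiv U Q"
  shows "is_smallest_completion (RS U P Q) (IRS U P Q) (\<lambda>p. p)"
proof -
  interpret two_equivs U P Q using assms by unfold_locales
  show ?thesis
  proof (rule is_smallest_completionI)
    show "is_completion (RS U P Q) (IRS U P Q) (\<lambda>p. p)"
      using partial_order_componentwise complete_lattice_IRS RS_sub_IRS
      by (auto simp: is_completion_def order_embedding_def)
  next
    fix p q assume "p \<in> carrier (IRS U P Q)"
      "\<And>s. \<lbrakk>s \<in> carrier (RS U P Q); s \<sqsubseteq>\<^bsub>IRS U P Q\<^esub> p\<rbrakk> \<Longrightarrow> s \<sqsubseteq>\<^bsub>IRS U P Q\<^esub> q"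
    then show "p \<sqsubseteq>\<^bsub>IRS U P Q\<^esub> q" using RS_join_dense[of p "fst q" "snd q"] by simp
  next
    fix p q assume "p \<in> carrier (IRS U P Q)" "q \<in> carrier (IRS U P Q)"
      "\<And>s. \<lbrakk>s \<in> carrier (RS U P Q); q \<sqsubseteq>\<^bsub>IRS U P Q\<^esub> s\<rbrakk> \<Longrightarrow> p \<sqsubseteq>\<^bsub>IRS U P Q\<^esub> s"
    \<comment> \<open>The roles are exchanged here: \<open>q\<close> is the element approximated
      from above and \<open>p\<close> is the lower bound compared with it.\<close>
    then show "p \<sqsubseteq>\<^bsub>IRS U P Q\<^esub> q" using RS_meet_dense[of q "fst p" "snd p"] by simp
  qed
qed

end
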